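(* Let $R$ be a ring. The following hold for right $R$-modules: \begin{itemize} \item[(1)] Every direct summand of a CS-Rickart module is a CS-Rickart module. \item[(2)] Every direct summand of a d-CS-Rickart module is a d-CS-Rickart module. \end{itemize}
   Context: All rings are associative with nonzero identity; modules are unitary right modules. A module $M$ is CS-Rickart if for every $\varphi\in\mathrm{End}_R(M)$, $\mathrm{Ker}\,\varphi$ is an essential submodule of a direct summand of $M$. A submodule $N$ of $M$ lies above a direct summand of $M$ if there is a decomposition $M=N_1\oplus N_2$ such that $N_1\subset N$ and $N_2\cap N$ is small in $N_2$ (a submodule $K$ of $L$ is small if $K+X=L$ implies $X=L$). A module $M$ is d-CS-Rickart if for every $\varphi\in\mathrm{End}_R(M)$, $\mathrm{Im}\,\varphi$ lies above a direct summand of $M$. *)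

theory Defs
  imports "HOL-Algebra.Module" "HOL-Algebra.AbelCoset"
begin

(* The library locale module requires a commutative ring, so right modules over an
   arbitrary ring are introduced here on the same record type.  The term
   smult M r x stands for the right action x r; this is why the scalars are swapped in
   right_smult_assoc, which reads x (a b) = (x a) b.  The fields mult and one of M are unused.
   The library locale submodule assumes nothing about the ring and is used as it is.  A
   submodule H of M, regarded as a module, is M with its carrier replaced by H. *)

locale right_module = R?: ring R + M?: abelian_group M
  for R :: "('a, 'r) ring_scheme" (structure) and M :: "('a, 'b, 'm) module_scheme" (structure) +
  assumes right_smult_closed:
      "\<lbrakk>a \<in> carrier R; x \<in> carrier M\<rbrakk> \<Longrightarrow> a \<odot>\<^bsub>M\<^esub> x \<in> carrier M"
    and right_smult_ring_distr:
      "\<lbrakk>a \<in> carrier R; b \<in> carrier R; x \<in> carrier M\<rbrakk> \<Longrightarrow>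
       (a \<oplus>\<^bsub>R\<^esub> b) \<odot>\<^bsub>M\<^esub> x = (a \<odot>\<^bsub>M\<^esub> x) \<oplus>\<^bsub>M\<^esub> (b \<odot>\<^bsub>M\<^esub> x)"
    and right_smult_add_distr:
      "\<lbrakk>a \<in> carrier R; x \<in> carrier M; y \<in> carrier M\<rbrakk> \<Longrightarrow>
       a \<odot>\<^bsub>M\<^esub> (x \<oplus>\<^bsub>M\<^esub> y) = (a \<odot>\<^bsub>M\<^esub> x) \<oplus>\<^bsub>M\<^esub> (a \<odot>\<^bsub>M\<^esub> y)"
    and right_smult_assoc:
      "\<lbrakk>a \<in> carrier R; b \<in> carrier R; x \<in> carrier M\<rbrakk> \<Longrightarrow>
       (a \<otimes>\<^bsub>R\<^esub> b) \<odot>\<^bsub>M\<^esub> x = b \<odot>\<^bsub>M\<^esub> (a \<odot>\<^bsub>M\<^esub> x)"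
    and right_smult_one:
      "x \<in> carrier M \<Longrightarrow> \<one>\<^bsub>R\<^esub> \<odot>\<^bsub>M\<^esub> x = x"

(* Values outside the carrier are unconstrained; only the kernel and the image of the carrier
   are ever taken. *)
definition module_End ::
    "('a, 'r) ring_scheme \<Rightarrow> ('a, 'b, 'm) module_scheme \<Rightarrow> ('b \<Rightarrow> 'b) set" where
  "module_End R M =
     {h \<in> hom (add_monoid M) (add_monoid M).
        \<forall>a\<in>carrier R. \<forall>x\<in>carrier M. h (a \<odot>\<^bsub>M\<^esub> x) = a \<odot>\<^bsub>M\<^esub> h x}"

definition direct_decomposition ::
    "('a, 'r) ring_scheme \<Rightarrow> ('a, 'b, 'm) module_scheme \<Rightarrow> 'b set \<Rightarrow> 'b set \<Rightarrow> bool" where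
  "direct_decomposition R M A B \<longleftrightarrow>
     submodule A R M \<and> submodule B R M \<and>
     A <+>\<^bsub>M\<^esub> B = carrier M \<and> A \<inter> B = {\<zero>\<^bsub>M\<^esub>}"

definition direct_summand ::
    "('a, 'r) ring_scheme \<Rightarrow> ('a, 'b, 'm) module_scheme \<Rightarrow> 'b set \<Rightarrow> bool" where
  "direct_summand R M A \<longleftrightarrow> (\<exists>B. direct_decomposition R M A B)"

definition essential_submodule ::
    "('a, 'r) ring_scheme \<Rightarrow> ('a, 'b, 'm) module_scheme \<Rightarrow> 'b set \<Rightarrow> bool" where
  "essential_submodule R L K \<longleftrightarrow>
     submodule K R L \<and>
     (\<forall>X. submodule X R L \<and> K \<inter> X = {\<zero>\<^bsub>L\<^esub>} \<longrightarrow> X = {\<zero>\<^bsub>L\<^esub>})"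

definition small_submodule ::
    "('a, 'r) ring_scheme \<Rightarrow> ('a, 'b, 'm) module_scheme \<Rightarrow> 'b set \<Rightarrow> bool" where
  "small_submodule R L K \<longleftrightarrow>
     submodule K R L \<and>
     (\<forall>X. submodule X R L \<and> K <+>\<^bsub>L\<^esub> X = carrier L \<longrightarrow> X = carrier L)"

definition lies_above_direct_summand ::
    "('a, 'r) ring_scheme \<Rightarrow> ('a, 'b, 'm) module_scheme \<Rightarrow> 'b set \<Rightarrow> bool" where
  "lies_above_direct_summand R M N \<longleftrightarrow>
     submodule N R M \<and>
     (\<exists>N1 N2. direct_decomposition R M N1 N2 \<and> N1 \<subseteq> N \<and>
              small_submodule R (M\<lparr>carrier := N2\<rparr>) (N2 \<inter> N))"

definition CS_Rickart ::
    "('a, 'r) ring_scheme \<Rightarrow> ('a, 'b, 'm) module_scheme \<Rightarrow> bool" where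
  "CS_Rickart R M \<longleftrightarrow>
     right_module R M \<and>
     (\<forall>\<phi>\<in>module_End R M. \<exists>L. direct_summand R M L \<and>
        essential_submodule R (M\<lparr>carrier := L\<rparr>) (a_kernel M M \<phi>))"

definition d_CS_Rickart ::
    "('a, 'r) ring_scheme \<Rightarrow> ('a, 'b, 'm) module_scheme \<Rightarrow> bool" where
  "d_CS_Rickart R M \<longleftrightarrow>
     right_module R M \<and>
     (\<forall>\<phi>\<in>module_End R M. lies_above_direct_summand R M (\<phi> ` carrier M))"

end

theory Submission
  imports Defs
begin

text \<open>
  Both parts are cases of one scheme. Write \<open>M = N \<oplus> K\<close> and extend an endomorphism \<open>\<phi>\<close> of \<open>N\<close>
  to the endomorphism \<open>\<psi>\<close> of \<open>M\<close> that vanishes on \<open>K\<close> (\<open>endomorphism_extension_by_zero\<close>), so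
  that \<open>Ker \<psi> = Ker \<phi> \<oplus> K\<close> and \<open>Im \<psi> = Im \<phi>\<close>. The hypothesis on \<open>M\<close>, applied to \<open>\<psi>\<close>, gives
  summands of \<open>M\<close>, which have to be cut down.

  If \<open>Ker \<psi>\<close> is essential in a summand \<open>L\<close>, then \<open>K \<subseteq> L\<close>, and \<open>Ker \<phi> = Ker \<psi> \<inter> N\<close> is essential
  in \<open>N \<inter> L\<close>. If \<open>M = N1 \<oplus> N2\<close> with \<open>N1 \<subseteq> Im \<psi>\<close> and \<open>N2 \<inter> Im \<psi>\<close> small in \<open>N2\<close>, then
  \<open>N1 \<subseteq> N\<close>, so \<open>N = N1 \<oplus> (N2 \<inter> N)\<close>, and \<open>N2 \<inter> Im \<phi>\<close> lies in \<open>N2 \<inter> N\<close>. Smallness in \<open>N2\<close> passes to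
  \<open>N2 \<inter> N\<close> if the latter is a summand of \<open>N2\<close>.

  What is left is in both cases the same statement, \<open>direct_summand_inter\<close>: if \<open>M = A \<oplus> B\<close> and
  a summand \<open>L\<close> of \<open>M\<close> contains \<open>A\<close>, then \<open>B \<inter> L\<close> is a summand of \<open>B\<close>. It is used
  with \<open>A = K\<close>, \<open>B = N\<close> for the kernels, and with \<open>A = N1\<close>, \<open>B = N2\<close>, \<open>L = N\<close> for the images. By
  modularity \<open>L = A \<oplus> (B \<inter> L)\<close>; hence \<open>B \<inter> L\<close> is a summand of a summand of \<open>M\<close>, so a summand of
  \<open>M\<close>, and by modularity again a summand of every submodule in between, such as \<open>B\<close>.
\<close>

section \<open>Submodules of right modules\<close>

lemma set_add_restrict [simp]: "A <+>\<^bsub>M\<lparr>carrier := N\<rparr>\<^esub> B = A <+>\<^bsub>M\<^esub> B"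
  by (simp add: set_add_def')

lemma mem_set_add_iff: "x \<in> A <+>\<^bsub>M\<^esub> B \<longleftrightarrow> (\<exists>a\<in>A. \<exists>b\<in>B. x = a \<oplus>\<^bsub>M\<^esub> b)"
  by (auto simp: set_add_def')

lemma add_mem_set_add: "a \<in> A \<Longrightarrow> b \<in> B \<Longrightarrow> a \<oplus>\<^bsub>M\<^esub> b \<in> A <+>\<^bsub>M\<^esub> B"
  by (auto simp: mem_set_add_iff)

context right_module
begin

lemma smult_zero_left:
  assumes "x \<in> carrier M"
  shows "\<zero>\<^bsub>R\<^esub> \<odot>\<^bsub>M\<^esub> x = \<zero>\<^bsub>M\<^esub>"
proof -
  have c: "\<zero>\<^bsub>R\<^esub> \<odot>\<^bsub>M\<^esub> x \<in> carrier M"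
    using assms by (simp add: right_smult_closed)
  have "\<zero>\<^bsub>R\<^esub> \<odot>\<^bsub>M\<^esub> x \<oplus>\<^bsub>M\<^esub> \<zero>\<^bsub>R\<^esub> \<odot>\<^bsub>M\<^esub> x = \<zero>\<^bsub>R\<^esub> \<odot>\<^bsub>M\<^esub> x"
    using right_smult_ring_distr[of "\<zero>\<^bsub>R\<^esub>" "\<zero>\<^bsub>R\<^esub>" x] assms by simp
  then show ?thesis
    using c by (metis M.add.r_cancel_one)
qed

lemma smult_minus_one:
  assumes "x \<in> carrier M"
  shows "(\<ominus>\<^bsub>R\<^esub> \<one>\<^bsub>R\<^esub>) \<odot>\<^bsub>M\<^esub> x = \<ominus>\<^bsub>M\<^esub> x"
proof -
  have "(\<ominus>\<^bsub>R\<^esub> \<one>\<^bsub>R\<^esub>) \<odot>\<^bsub>M\<^esub> x \<oplus>\<^bsub>M\<^esub> x = \<zero>\<^bsub>M\<^esub>"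
    using right_smult_ring_distr[of "\<ominus>\<^bsub>R\<^esub> \<one>\<^bsub>R\<^esub>" "\<one>\<^bsub>R\<^esub>" x] assms
    by (simp add: right_smult_one smult_zero_left R.l_neg)
  then show ?thesis
    using assms by (simp add: M.minus_equality right_smult_closed)
qed

text \<open>
  Closure under negation comes from the scalar \<open>-1\<close>. Without it the criterion no longer mentions
  \<^term>\<open>a_inv\<close>, which is defined through the carrier, so it can be compared directly between \<open>M\<close> and
  a submodule regarded as a module.
\<close>
lemma submodule_iff:
  "submodule H R M \<longleftrightarrow>
     H \<subseteq> carrier M \<and> \<zero>\<^bsub>M\<^esub> \<in> H \<and> (\<forall>x\<in>H. \<forall>y\<in>H. x \<oplus>\<^bsub>M\<^esub> y \<in> H) \<and>
     (\<forall>a\<in>carrier R. \<forall>x\<in>H. a \<odot>\<^bsub>M\<^esub> x \<in> H)" (is "?L \<longleftrightarrow> ?P")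
proof
  assume ?L
  then interpret submodule H R M .
  show ?P
    using subset one_closed m_closed by auto
next
  assume P: ?P
  then have "\<ominus>\<^bsub>M\<^esub> x \<in> H" if "x \<in> H" for x
    using smult_minus_one[of x] that by (metis R.a_inv_closed R.one_closed subsetD)
  with P show ?L
    by (auto simp: submodule_def submodule_axioms_def subgroup_def a_inv_def)
qed

lemma minus_mem_submodule:
  assumes "submodule H R M" "x \<in> H"
  shows "\<ominus>\<^bsub>M\<^esub> x \<in> H"
  using assms smult_minus_one[of x] unfolding submodule_iff
  by (metis R.a_inv_closed R.one_closed subsetD)

lemma right_module_submodule:
  assumes N: "submodule N R M"
  shows "right_module R (M\<lparr>carrier := N\<rparr>)"
proof -
  have N': "N \<subseteq> carrier M" "\<zero>\<^bsub>M\<^esub> \<in> N" "\<And>x y. x \<in> N \<Longrightarrow> y \<in> N \<Longrightarrow> x \<oplus>\<^bsub>M\<^esub> y \<in> N"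
    "\<And>a x. a \<in> carrier R \<Longrightarrow> x \<in> N \<Longrightarrow> a \<odot>\<^bsub>M\<^esub> x \<in> N"
    using N by (auto simp: submodule_iff)
  have "abelian_group (M\<lparr>carrier := N\<rparr>)"
  proof (rule abelian_groupI)
    fix x assume x: "x \<in> carrier (M\<lparr>carrier := N\<rparr>)"
    then have "\<ominus>\<^bsub>M\<^esub> x \<in> N" "\<ominus>\<^bsub>M\<^esub> x \<oplus>\<^bsub>M\<^esub> x = \<zero>\<^bsub>M\<^esub>"
      using minus_mem_submodule[OF N] N' by (auto simp: M.l_neg subset_iff)
    then show "\<exists>y\<in>carrier (M\<lparr>carrier := N\<rparr>). y \<oplus>\<^bsub>M\<lparr>carrier := N\<rparr>\<^esub> x = \<zero>\<^bsub>M\<lparr>carrier := N\<rparr>\<^esub>"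
      by auto
  qed (use N' in \<open>auto simp: subset_iff M.add.m_ac\<close>)
  moreover have "ring R"
    by (rule R.ring_axioms)
  ultimately show ?thesis
    using N' unfolding right_module_def right_module_axioms_def
    by (auto simp: subset_iff right_smult_ring_distr right_smult_add_distr
        right_smult_assoc right_smult_one)
qed

lemma submodule_restrict_iff:
  assumes "submodule N R M"
  shows "submodule H R (M\<lparr>carrier := N\<rparr>) \<longleftrightarrow> submodule H R M \<and> H \<subseteq> N"
proof -
  interpret N: right_module R "M\<lparr>carrier := N\<rparr>"
    by (rule right_module_submodule[OF assms])
  show ?thesis
    using assms unfolding N.submodule_iff submodule_iff by auto
qed

lemma submodule_inter:
  assumes "submodule A R M" "submodule B R M"
  shows "submodule (A \<inter> B) R M"
  using assms by (auto simp: submodule_iff)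

lemma submodule_set_add:
  assumes A: "submodule A R M" and B: "submodule B R M"
  shows "submodule (A <+>\<^bsub>M\<^esub> B) R M"
proof -
  have c: "A \<subseteq> carrier M" "B \<subseteq> carrier M" "\<zero>\<^bsub>M\<^esub> \<in> A" "\<zero>\<^bsub>M\<^esub> \<in> B"
    using A B by (auto simp: submodule_iff)
  have add: "(a \<oplus>\<^bsub>M\<^esub> b) \<oplus>\<^bsub>M\<^esub> (a' \<oplus>\<^bsub>M\<^esub> b') \<in> A <+>\<^bsub>M\<^esub> B"
    if "a \<in> A" "b \<in> B" "a' \<in> A" "b' \<in> B" for a b a' b'
  proof -
    have "(a \<oplus>\<^bsub>M\<^esub> b) \<oplus>\<^bsub>M\<^esub> (a' \<oplus>\<^bsub>M\<^esub> b') = (a \<oplus>\<^bsub>M\<^esub> a') \<oplus>\<^bsub>M\<^esub> (b \<oplus>\<^bsub>M\<^esub> b')"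
      using that c by (simp add: subset_iff M.add.m_ac)
    then show ?thesis
      using that A B by (simp add: add_mem_set_add submodule_iff)
  qed
  have smult: "r \<odot>\<^bsub>M\<^esub> (a \<oplus>\<^bsub>M\<^esub> b) \<in> A <+>\<^bsub>M\<^esub> B"
    if "r \<in> carrier R" "a \<in> A" "b \<in> B" for r a b
  proof -
    have "r \<odot>\<^bsub>M\<^esub> (a \<oplus>\<^bsub>M\<^esub> b) = r \<odot>\<^bsub>M\<^esub> a \<oplus>\<^bsub>M\<^esub> r \<odot>\<^bsub>M\<^esub> b"
      using that c by (simp add: subset_iff right_smult_add_distr)
    then show ?thesis
      using that A B by (simp add: add_mem_set_add submodule_iff)
  qed
  have "\<zero>\<^bsub>M\<^esub> \<in> A <+>\<^bsub>M\<^esub> B"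
    unfolding mem_set_add_iff using c by (metis M.l_zero M.zero_closed)
  moreover have "A <+>\<^bsub>M\<^esub> B \<subseteq> carrier M"
    using c by (auto simp: mem_set_add_iff subset_iff)
  ultimately show ?thesis
    unfolding submodule_iff using add smult by (auto simp: mem_set_add_iff[of _ M A B])
qed

lemma set_add_zero_right:
  assumes "A \<subseteq> carrier M"
  shows "A <+>\<^bsub>M\<^esub> {\<zero>\<^bsub>M\<^esub>} = A"
  using assms by (auto simp: set_add_def' subset_iff)

lemma set_add_commute:
  assumes "A \<subseteq> carrier M" "B \<subseteq> carrier M"
  shows "A <+>\<^bsub>M\<^esub> B = B <+>\<^bsub>M\<^esub> A"
proof -
  have "a \<oplus>\<^bsub>M\<^esub> b = b \<oplus>\<^bsub>M\<^esub> a" if "a \<in> A" "b \<in> B" for a b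
    using that assms by (simp add: subset_iff M.a_comm)
  then show ?thesis
    by (auto simp: mem_set_add_iff) metis+
qed

lemma set_add_assoc:
  assumes "A \<subseteq> carrier M" "B \<subseteq> carrier M" "C \<subseteq> carrier M"
  shows "(A <+>\<^bsub>M\<^esub> B) <+>\<^bsub>M\<^esub> C = A <+>\<^bsub>M\<^esub> (B <+>\<^bsub>M\<^esub> C)"
  using M.add.set_mult_assoc[of A B C] assms by (simp add: set_add_def)

lemma modular_law:
  assumes L: "submodule L R M" and A: "A \<subseteq> L" and B: "B \<subseteq> carrier M"
  shows "(A <+>\<^bsub>M\<^esub> B) \<inter> L = A <+>\<^bsub>M\<^esub> (B \<inter> L)"
proof
  show "(A <+>\<^bsub>M\<^esub> B) \<inter> L \<subseteq> A <+>\<^bsub>M\<^esub> (B \<inter> L)"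
  proof
    fix x assume x: "x \<in> (A <+>\<^bsub>M\<^esub> B) \<inter> L"
    then obtain a b where ab: "a \<in> A" "b \<in> B" "x = a \<oplus>\<^bsub>M\<^esub> b"
      by (auto simp: mem_set_add_iff)
    have "a \<in> carrier M" "b \<in> carrier M"
      using ab A B L by (auto simp: submodule_iff)
    then have "b = \<ominus>\<^bsub>M\<^esub> a \<oplus>\<^bsub>M\<^esub> x"
      using ab by (simp add: M.r_neg1)
    moreover have "\<ominus>\<^bsub>M\<^esub> a \<oplus>\<^bsub>M\<^esub> x \<in> L"
      using x ab(1) A minus_mem_submodule[OF L, of a] L by (auto simp: submodule_iff)
    ultimately have "b \<in> L"
      by metis
    with ab show "x \<in> A <+>\<^bsub>M\<^esub> (B \<inter> L)"
      by (auto simp: mem_set_add_iff)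
  qed
  show "A <+>\<^bsub>M\<^esub> (B \<inter> L) \<subseteq> (A <+>\<^bsub>M\<^esub> B) \<inter> L"
  proof
    fix x assume "x \<in> A <+>\<^bsub>M\<^esub> (B \<inter> L)"
    then obtain a b where "a \<in> A" "b \<in> B" "b \<in> L" "x = a \<oplus>\<^bsub>M\<^esub> b"
      by (auto simp: mem_set_add_iff)
    then show "x \<in> (A <+>\<^bsub>M\<^esub> B) \<inter> L"
      using A L by (auto simp: submodule_iff intro: add_mem_set_add)
  qed
qed

section \<open>Direct decompositions\<close>

lemma direct_decomposition_commute:
  assumes "direct_decomposition R M A B"
  shows "direct_decomposition R M B A"
  using assms set_add_commute[of A B] unfolding direct_decomposition_def submodule_iff by auto

lemma direct_decomposition_unique:
  assumes D: "direct_decomposition R M A B"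
    and "a \<in> A" "a' \<in> A" "b \<in> B" "b' \<in> B" and eq: "a \<oplus>\<^bsub>M\<^esub> b = a' \<oplus>\<^bsub>M\<^esub> b'"
  shows "a = a'"
proof -
  have A: "submodule A R M" and B: "submodule B R M" and disj: "A \<inter> B = {\<zero>\<^bsub>M\<^esub>}"
    using D by (auto simp: direct_decomposition_def)
  have c: "a \<in> carrier M" "a' \<in> carrier M" "b \<in> carrier M" "b' \<in> carrier M"
    using assms A B by (auto simp: submodule_iff)
  have "\<ominus>\<^bsub>M\<^esub> a' \<oplus>\<^bsub>M\<^esub> a = \<ominus>\<^bsub>M\<^esub> a' \<oplus>\<^bsub>M\<^esub> ((a \<oplus>\<^bsub>M\<^esub> b) \<oplus>\<^bsub>M\<^esub> \<ominus>\<^bsub>M\<^esub> b)"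
    using c by (simp add: M.a_assoc M.r_neg)
  also have "\<dots> = b' \<oplus>\<^bsub>M\<^esub> \<ominus>\<^bsub>M\<^esub> b"
    unfolding eq using c by (simp add: M.a_assoc M.r_neg1)
  finally have e: "\<ominus>\<^bsub>M\<^esub> a' \<oplus>\<^bsub>M\<^esub> a = b' \<oplus>\<^bsub>M\<^esub> \<ominus>\<^bsub>M\<^esub> b" .
  have "\<ominus>\<^bsub>M\<^esub> a' \<oplus>\<^bsub>M\<^esub> a \<in> A"
    using A assms minus_mem_submodule[OF A] by (auto simp: submodule_iff)
  moreover have "b' \<oplus>\<^bsub>M\<^esub> \<ominus>\<^bsub>M\<^esub> b \<in> B"
    using B assms minus_mem_submodule[OF B] by (auto simp: submodule_iff)
  ultimately have "\<ominus>\<^bsub>M\<^esub> a' \<oplus>\<^bsub>M\<^esub> a = \<zero>\<^bsub>M\<^esub>"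
    using e disj by auto
  then show ?thesis
    using c by (metis M.add.inv_closed M.add.inv_inv M.minus_equality M.a_comm)
qed

text \<open>The trace of a decomposition on a submodule containing one of the two terms: an instance of
  modularity.\<close>
lemma direct_decomposition_restrict:
  assumes D: "direct_decomposition R M A B" and L: "submodule L R M" and "A \<subseteq> L"
  shows "direct_decomposition R (M\<lparr>carrier := L\<rparr>) A (B \<inter> L)"
proof -
  have A: "submodule A R M" and B: "submodule B R M"
    and sum: "A <+>\<^bsub>M\<^esub> B = carrier M" and disj: "A \<inter> B = {\<zero>\<^bsub>M\<^esub>}"
    using D by (auto simp: direct_decomposition_def)
  have "A <+>\<^bsub>M\<^esub> (B \<inter> L) = L"
    using modular_law[OF L \<open>A \<subseteq> L\<close>, of B] sum B L by (auto simp: submodule_iff)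
  moreover have "A \<inter> (B \<inter> L) = {\<zero>\<^bsub>M\<^esub>}"
    using disj \<open>A \<subseteq> L\<close> by auto
  ultimately show ?thesis
    using A B L \<open>A \<subseteq> L\<close> submodule_inter[OF B L]
    by (simp add: direct_decomposition_def submodule_restrict_iff)
qed

lemma direct_decomposition_refine:
  assumes D: "direct_decomposition R M A B"
    and D': "direct_decomposition R (M\<lparr>carrier := A\<rparr>) C E"
  shows "direct_decomposition R M C (E <+>\<^bsub>M\<^esub> B)"
proof -
  have A: "submodule A R M" and B: "submodule B R M"
    and sum: "A <+>\<^bsub>M\<^esub> B = carrier M" and disj: "A \<inter> B = {\<zero>\<^bsub>M\<^esub>}"
    using D by (auto simp: direct_decomposition_def)
  have C: "submodule C R M" "C \<subseteq> A" and E: "submodule E R M" "E \<subseteq> A"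
    and sum': "C <+>\<^bsub>M\<^esub> E = A" and disj': "C \<inter> E = {\<zero>\<^bsub>M\<^esub>}"
    using D' by (auto simp: direct_decomposition_def submodule_restrict_iff[OF A])
  have sub: "A \<subseteq> carrier M" "B \<subseteq> carrier M" "C \<subseteq> carrier M" "E \<subseteq> carrier M"
    using A B C E by (auto simp: submodule_iff)
  have EB: "submodule (E <+>\<^bsub>M\<^esub> B) R M"
    by (rule submodule_set_add[OF E(1) B])
  have "C <+>\<^bsub>M\<^esub> (E <+>\<^bsub>M\<^esub> B) = carrier M"
    using set_add_assoc[of C E B] sub sum sum' by simp
  \<comment> \<open>By modularity the part of \<open>E + B\<close> inside \<open>A\<close>, and so its intersection with \<open>C\<close>, lies in \<open>E\<close>.\<close>
  moreover have "(E <+>\<^bsub>M\<^esub> B) \<inter> A = E"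
    using modular_law[OF A E(2), of B] sub disj set_add_zero_right[of E] by (simp add: Int_commute)
  then have "C \<inter> (E <+>\<^bsub>M\<^esub> B) = {\<zero>\<^bsub>M\<^esub>}"
    using C E disj' by blast
  ultimately show ?thesis
    using C EB by (simp add: direct_decomposition_def)
qed

lemma direct_summand_submodule:
  "direct_summand R M A \<Longrightarrow> submodule A R M"
  by (auto simp: direct_summand_def direct_decomposition_def)

text \<open>Modularity makes \<open>B \<inter> L\<close> a complement of \<open>A\<close> in \<open>L\<close>. As a summand of the summand \<open>L\<close>, it is
  a summand of \<open>M\<close>, and hence of the smaller module \<open>B\<close> that contains it.\<close>
lemma direct_summand_inter:
  assumes D: "direct_decomposition R M A B" and L: "direct_summand R M L" and AL: "A \<subseteq> L"
  shows "direct_summand R (M\<lparr>carrier := B\<rparr>) (B \<inter> L)"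
proof -
  have Ls: "submodule L R M"
    by (rule direct_summand_submodule[OF L])
  obtain L' where L': "direct_decomposition R M L L'"
    using L by (auto simp: direct_summand_def)
  have B: "submodule B R M"
    using D by (simp add: direct_decomposition_def)
  interpret L: right_module R "M\<lparr>carrier := L\<rparr>"
    by (rule right_module_submodule[OF Ls])
  have "direct_decomposition R (M\<lparr>carrier := L\<rparr>) (B \<inter> L) A"
    by (rule L.direct_decomposition_commute[OF direct_decomposition_restrict[OF D Ls AL]])
  from direct_decomposition_restrict[OF direct_decomposition_refine[OF L' this] B]
  show ?thesis
    by (auto simp: direct_summand_def)
qed

section \<open>Essential and small submodules\<close>

lemma essential_submodule_inter:
  assumes K: "essential_submodule R M K" and T: "submodule T R M"
  shows "essential_submodule R (M\<lparr>carrier := T\<rparr>) (K \<inter> T)"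
proof -
  have Ks: "submodule K R M"
    using K by (simp add: essential_submodule_def)
  have "X = {\<zero>\<^bsub>M\<^esub>}" if "submodule X R M" "X \<subseteq> T" "K \<inter> T \<inter> X = {\<zero>\<^bsub>M\<^esub>}" for X
  proof -
    have "K \<inter> X = {\<zero>\<^bsub>M\<^esub>}"
      using that by auto
    then show ?thesis
      using K that by (auto simp: essential_submodule_def)
  qed
  then show ?thesis
    using submodule_inter[OF Ks T] by (simp add: essential_submodule_def submodule_restrict_iff[OF T])
qed

text \<open>A complement \<open>C\<close> of \<open>Q\<close> turns a submodule \<open>X\<close> of \<open>Q\<close> into the submodule \<open>X + C\<close> of \<open>M\<close>, which
  meets \<open>Q\<close> exactly in \<open>X\<close>, and an equation \<open>S + X = Q\<close> into \<open>S + (X + C) = M\<close>. An arbitrary submodule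
  \<open>Q\<close> would not do: the socle of the integers modulo 4 is small there, but not in itself.\<close>
lemma small_submodule_direct_summand:
  assumes S: "small_submodule R M S" and Q: "direct_summand R M Q" and SQ: "S \<subseteq> Q"
  shows "small_submodule R (M\<lparr>carrier := Q\<rparr>) S"
proof -
  obtain C where D: "direct_decomposition R M Q C"
    using Q by (auto simp: direct_summand_def)
  have Qs: "submodule Q R M" and Cs: "submodule C R M"
    and sum: "Q <+>\<^bsub>M\<^esub> C = carrier M" and disj: "Q \<inter> C = {\<zero>\<^bsub>M\<^esub>}"
    using D by (auto simp: direct_decomposition_def)
  have Ss: "submodule S R M"
    using S by (simp add: small_submodule_def)
  have "X = Q" if X: "submodule X R M" "X \<subseteq> Q" and SX: "S <+>\<^bsub>M\<^esub> X = Q" for X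
  proof -
    have sub: "S \<subseteq> carrier M" "X \<subseteq> carrier M" "C \<subseteq> carrier M"
      using Ss X Cs by (auto simp: submodule_iff)
    have "S <+>\<^bsub>M\<^esub> (X <+>\<^bsub>M\<^esub> C) = carrier M"
      using set_add_assoc[of S X C] sub SX sum by simp
    then have XC: "X <+>\<^bsub>M\<^esub> C = carrier M"
      using S submodule_set_add[OF X(1) Cs] by (auto simp: small_submodule_def)
    have "Q = (X <+>\<^bsub>M\<^esub> C) \<inter> Q"
      using XC Qs by (auto simp: submodule_iff)
    also have "\<dots> = X"
      using modular_law[OF Qs X(2), of C] sub disj set_add_zero_right[of X] by (simp add: Int_commute)
    finally show ?thesis
      by simp
  qed
  then show ?thesis
    using Ss SQ by (simp add: small_submodule_def submodule_restrict_iff[OF Qs])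
qed

section \<open>Endomorphisms of a direct summand\<close>

lemma module_End_iff:
  "h \<in> module_End R M \<longleftrightarrow>
     (\<forall>x\<in>carrier M. h x \<in> carrier M) \<and>
     (\<forall>x\<in>carrier M. \<forall>y\<in>carrier M. h (x \<oplus>\<^bsub>M\<^esub> y) = h x \<oplus>\<^bsub>M\<^esub> h y) \<and>
     (\<forall>a\<in>carrier R. \<forall>x\<in>carrier M. h (a \<odot>\<^bsub>M\<^esub> x) = a \<odot>\<^bsub>M\<^esub> h x)"
  by (auto simp: module_End_def hom_def)

lemma module_End_zero:
  assumes "h \<in> module_End R M"
  shows "h \<zero>\<^bsub>M\<^esub> = \<zero>\<^bsub>M\<^esub>"
  using assms smult_zero_left[of "\<zero>\<^bsub>M\<^esub>"] smult_zero_left[of "h \<zero>\<^bsub>M\<^esub>"] unfolding module_End_iff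
  by (metis M.zero_closed R.zero_closed)

text \<open>The extension is \<open>\<phi>\<close> after the projection onto \<open>N\<close> along \<open>K\<close>.\<close>
lemma endomorphism_extension_by_zero:
  assumes D: "direct_decomposition R M N K" and phi: "\<phi> \<in> module_End R (M\<lparr>carrier := N\<rparr>)"
  obtains \<psi> where "\<psi> \<in> module_End R M" and "\<And>n k. n \<in> N \<Longrightarrow> k \<in> K \<Longrightarrow> \<psi> (n \<oplus>\<^bsub>M\<^esub> k) = \<phi> n"
proof -
  have N: "submodule N R M" and K: "submodule K R M" and sum: "N <+>\<^bsub>M\<^esub> K = carrier M"
    using D by (auto simp: direct_decomposition_def)
  have ph: "\<And>x. x \<in> N \<Longrightarrow> \<phi> x \<in> N" "\<And>x y. x \<in> N \<Longrightarrow> y \<in> N \<Longrightarrow> \<phi> (x \<oplus>\<^bsub>M\<^esub> y) = \<phi> x \<oplus>\<^bsub>M\<^esub> \<phi> y"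
    "\<And>a x. a \<in> carrier R \<Longrightarrow> x \<in> N \<Longrightarrow> \<phi> (a \<odot>\<^bsub>M\<^esub> x) = a \<odot>\<^bsub>M\<^esub> \<phi> x"
    using phi right_module.module_End_iff[OF right_module_submodule[OF N]] by auto
  define p where "p x = (THE n. n \<in> N \<and> (\<exists>k\<in>K. x = n \<oplus>\<^bsub>M\<^esub> k))" for x
  have p: "p (n \<oplus>\<^bsub>M\<^esub> k) = n" if "n \<in> N" "k \<in> K" for n k
    unfolding p_def using that direct_decomposition_unique[OF D] by (intro the_equality) blast+
  let ?\<psi> = "\<lambda>x. \<phi> (p x)"
  have split: "\<exists>n\<in>N. \<exists>k\<in>K. x = n \<oplus>\<^bsub>M\<^esub> k" if "x \<in> carrier M" for x
    using that by (simp add: sum[symmetric] mem_set_add_iff)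
  have sub: "\<And>x. x \<in> N \<Longrightarrow> x \<in> carrier M" "\<And>x. x \<in> K \<Longrightarrow> x \<in> carrier M"
    using N K by (auto simp: submodule_iff)
  have closed: "?\<psi> x \<in> carrier M" if "x \<in> carrier M" for x
    using split[OF that] p ph sub by auto
  have add: "?\<psi> (x \<oplus>\<^bsub>M\<^esub> y) = ?\<psi> x \<oplus>\<^bsub>M\<^esub> ?\<psi> y" if "x \<in> carrier M" "y \<in> carrier M" for x y
  proof -
    obtain n k n' k' where *: "n \<in> N" "k \<in> K" "x = n \<oplus>\<^bsub>M\<^esub> k" "n' \<in> N" "k' \<in> K" "y = n' \<oplus>\<^bsub>M\<^esub> k'"
      using split[OF \<open>x \<in> carrier M\<close>] split[OF \<open>y \<in> carrier M\<close>] by metis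
    have "x \<oplus>\<^bsub>M\<^esub> y = (n \<oplus>\<^bsub>M\<^esub> n') \<oplus>\<^bsub>M\<^esub> (k \<oplus>\<^bsub>M\<^esub> k')"
      using * by (simp add: sub M.add.m_ac)
    moreover have "n \<oplus>\<^bsub>M\<^esub> n' \<in> N" "k \<oplus>\<^bsub>M\<^esub> k' \<in> K"
      using * N K by (auto simp: submodule_iff)
    ultimately show ?thesis
      using * by (simp add: p ph)
  qed
  have smult: "?\<psi> (a \<odot>\<^bsub>M\<^esub> x) = a \<odot>\<^bsub>M\<^esub> ?\<psi> x" if "a \<in> carrier R" "x \<in> carrier M" for a x
  proof -
    obtain n k where *: "n \<in> N" "k \<in> K" "x = n \<oplus>\<^bsub>M\<^esub> k"
      using split[OF \<open>x \<in> carrier M\<close>] by metis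
    have "a \<odot>\<^bsub>M\<^esub> x = a \<odot>\<^bsub>M\<^esub> n \<oplus>\<^bsub>M\<^esub> a \<odot>\<^bsub>M\<^esub> k"
      using * that by (simp add: sub right_smult_add_distr)
    moreover have "a \<odot>\<^bsub>M\<^esub> n \<in> N" "a \<odot>\<^bsub>M\<^esub> k \<in> K"
      using * that N K by (auto simp: submodule_iff)
    ultimately show ?thesis
      using * that by (simp add: p ph)
  qed
  show thesis
  proof (rule that)
    show "?\<psi> \<in> module_End R M"
      using closed add smult by (auto simp: module_End_iff)
    show "?\<psi> (n \<oplus>\<^bsub>M\<^esub> k) = \<phi> n" if "n \<in> N" "k \<in> K" for n k
      using p that by simp
  qed
qed

section \<open>Direct summands of CS-Rickart and d-CS-Rickart modules\<close>

lemma CS_Rickart_direct_summand: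
  assumes CS: "CS_Rickart R M" and N: "direct_summand R M N"
  shows "CS_Rickart R (M\<lparr>carrier := N\<rparr>)"
  unfolding CS_Rickart_def
proof (intro conjI ballI)
  obtain K where D: "direct_decomposition R M N K"
    using N by (auto simp: direct_summand_def)
  have Ns: "submodule N R M"
    by (rule direct_summand_submodule[OF N])
  then interpret N: right_module R "M\<lparr>carrier := N\<rparr>"
    by (rule right_module_submodule)
  show "right_module R (M\<lparr>carrier := N\<rparr>)"
    by (rule N.right_module_axioms)
  fix \<phi> assume phi: "\<phi> \<in> module_End R (M\<lparr>carrier := N\<rparr>)"
  obtain \<psi> where psi: "\<psi> \<in> module_End R M"
    and ext: "\<And>n k. n \<in> N \<Longrightarrow> k \<in> K \<Longrightarrow> \<psi> (n \<oplus>\<^bsub>M\<^esub> k) = \<phi> n"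
    using endomorphism_extension_by_zero[OF D phi] by blast
  obtain L where L: "direct_summand R M L"
    and ess: "essential_submodule R (M\<lparr>carrier := L\<rparr>) (a_kernel M M \<psi>)"
    using CS psi by (auto simp: CS_Rickart_def)
  have Ls: "submodule L R M"
    by (rule direct_summand_submodule[OF L])
  interpret L: right_module R "M\<lparr>carrier := L\<rparr>"
    by (rule right_module_submodule[OF Ls])
  have kerL: "a_kernel M M \<psi> \<subseteq> L"
    using ess by (simp add: essential_submodule_def submodule_restrict_iff[OF Ls])
  have sub: "N \<subseteq> carrier M" "K \<subseteq> carrier M" and zero: "\<zero>\<^bsub>M\<^esub> \<in> N" "\<zero>\<^bsub>M\<^esub> \<in> K"
    using D by (auto simp: direct_decomposition_def submodule_iff)
  have "\<psi> k = \<zero>\<^bsub>M\<^esub>" if "k \<in> K" for k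
    using ext[OF zero(1) that] N.module_End_zero[OF phi] that sub by (simp add: subset_iff)
  then have KL: "K \<subseteq> L"
    using kerL sub by (auto simp: a_kernel_def')
  have "\<psi> n = \<phi> n" if "n \<in> N" for n
    using ext[OF that zero(2)] that sub by (simp add: subset_iff)
  then have ker: "a_kernel M M \<psi> \<inter> (N \<inter> L) = a_kernel (M\<lparr>carrier := N\<rparr>) (M\<lparr>carrier := N\<rparr>) \<phi>"
    using kerL sub by (auto simp: a_kernel_def')
  have "direct_summand R (M\<lparr>carrier := N\<rparr>) (N \<inter> L)"
    by (rule direct_summand_inter[OF direct_decomposition_commute[OF D] L KL])
  moreover have "submodule (N \<inter> L) R (M\<lparr>carrier := L\<rparr>)"
    using submodule_inter[OF Ns Ls] by (simp add: submodule_restrict_iff[OF Ls])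
  from L.essential_submodule_inter[OF ess this]
  have "essential_submodule R (M\<lparr>carrier := N\<rparr>\<lparr>carrier := N \<inter> L\<rparr>)
          (a_kernel (M\<lparr>carrier := N\<rparr>) (M\<lparr>carrier := N\<rparr>) \<phi>)"
    by (simp add: ker)
  ultimately show "\<exists>L. direct_summand R (M\<lparr>carrier := N\<rparr>) L \<and>
      essential_submodule R (M\<lparr>carrier := N\<rparr>\<lparr>carrier := L\<rparr>)
        (a_kernel (M\<lparr>carrier := N\<rparr>) (M\<lparr>carrier := N\<rparr>) \<phi>)"
    by blast
qed

lemma d_CS_Rickart_direct_summand:
  assumes dCS: "d_CS_Rickart R M" and N: "direct_summand R M N"
  shows "d_CS_Rickart R (M\<lparr>carrier := N\<rparr>)"
  unfolding d_CS_Rickart_def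
proof (intro conjI ballI)
  obtain K where D: "direct_decomposition R M N K"
    using N by (auto simp: direct_summand_def)
  have Ns: "submodule N R M"
    by (rule direct_summand_submodule[OF N])
  then interpret N: right_module R "M\<lparr>carrier := N\<rparr>"
    by (rule right_module_submodule)
  show "right_module R (M\<lparr>carrier := N\<rparr>)"
    by (rule N.right_module_axioms)
  fix \<phi> assume phi: "\<phi> \<in> module_End R (M\<lparr>carrier := N\<rparr>)"
  obtain \<psi> where psi: "\<psi> \<in> module_End R M"
    and ext: "\<And>n k. n \<in> N \<Longrightarrow> k \<in> K \<Longrightarrow> \<psi> (n \<oplus>\<^bsub>M\<^esub> k) = \<phi> n"
    using endomorphism_extension_by_zero[OF D phi] by blast
  have sum: "N <+>\<^bsub>M\<^esub> K = carrier M" and zero: "\<zero>\<^bsub>M\<^esub> \<in> K"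
    using D by (auto simp: direct_decomposition_def submodule_iff)
  have im: "\<psi> ` carrier M = \<phi> ` N"
  proof
    show "\<psi> ` carrier M \<subseteq> \<phi> ` N"
      using ext by (auto simp: sum[symmetric] mem_set_add_iff)
    show "\<phi> ` N \<subseteq> \<psi> ` carrier M"
    proof
      fix y assume "y \<in> \<phi> ` N"
      then obtain n where "n \<in> N" "y = \<phi> n"
        by auto
      with ext[OF this(1) zero] zero show "y \<in> \<psi> ` carrier M"
        unfolding sum[symmetric] by (metis \<open>y = \<phi> n\<close> \<open>n \<in> N\<close> add_mem_set_add image_eqI)
    qed
  qed
  have imN: "\<phi> ` N \<subseteq> N"
    using phi by (auto simp: N.module_End_iff)
  obtain N1 N2 where ims: "submodule (\<phi> ` N) R M" and D12: "direct_decomposition R M N1 N2"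
    and N1: "N1 \<subseteq> \<phi> ` N" and small: "small_submodule R (M\<lparr>carrier := N2\<rparr>) (N2 \<inter> \<phi> ` N)"
    using dCS psi by (auto simp: d_CS_Rickart_def lies_above_direct_summand_def im)
  have N1N: "N1 \<subseteq> N"
    using N1 imN by blast
  have "submodule N2 R M"
    using D12 by (simp add: direct_decomposition_def)
  then interpret N2: right_module R "M\<lparr>carrier := N2\<rparr>"
    by (rule right_module_submodule)
  have "small_submodule R (M\<lparr>carrier := N2\<rparr>\<lparr>carrier := N2 \<inter> N\<rparr>) (N2 \<inter> \<phi> ` N)"
    using imN by (intro N2.small_submodule_direct_summand[OF small]
        direct_summand_inter[OF D12 N N1N]) auto
  moreover have "N2 \<inter> N \<inter> \<phi> ` N = N2 \<inter> \<phi> ` N"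
    using imN by blast
  ultimately have "small_submodule R (M\<lparr>carrier := N\<rparr>\<lparr>carrier := N2 \<inter> N\<rparr>) (N2 \<inter> N \<inter> \<phi> ` N)"
    by simp
  moreover have "direct_decomposition R (M\<lparr>carrier := N\<rparr>) N1 (N2 \<inter> N)"
    by (rule direct_decomposition_restrict[OF D12 Ns N1N])
  moreover have "submodule (\<phi> ` N) R (M\<lparr>carrier := N\<rparr>)"
    using ims imN by (simp add: submodule_restrict_iff[OF Ns])
  ultimately show "lies_above_direct_summand R (M\<lparr>carrier := N\<rparr>)
      (\<phi> ` carrier (M\<lparr>carrier := N\<rparr>))"
    unfolding lies_above_direct_summand_def using N1 by auto
qed

end

theorem lemma2p1:
  fixes R :: "('a, 'r) ring_scheme"
    and M :: "('a, 'b, 'm) module_scheme"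
    and N :: "'b set"
  assumes "ring R"
    and "\<one>\<^bsub>R\<^esub> \<noteq> \<zero>\<^bsub>R\<^esub>"
    and "right_module R M"
    and "direct_summand R M N"
  shows "(CS_Rickart R M \<longrightarrow> CS_Rickart R (M\<lparr>carrier := N\<rparr>)) \<and>
         (d_CS_Rickart R M \<longrightarrow> d_CS_Rickart R (M\<lparr>carrier := N\<rparr>))"
  using right_module.CS_Rickart_direct_summand[OF assms(3) _ assms(4)]
    right_module.d_CS_Rickart_direct_summand[OF assms(3) _ assms(4)] by blast

end
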